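(* Let $k\in\mathbb{N}$ with $k\geq 2$, let $m\in\mathbb{N}$, and let $G=\bigoplus_{i=0}^{m-1}\mathbb{Q}=\mathbb{Q}^m$. Then there is a colouring of $G$ with $72$ colours such that, for every $\vec u\in G$ and every infinite subset $X$ of $G$, there is some $\vec x\in X$ such that $\vec x+\vec u$ and $k\vec x$ have different colours.
   Context: Here $k\vec x$ denotes the scalar multiple of $\vec x$ by $k$ (coordinatewise multiplication by $k$). *)

theory Defs
  imports "Jordan_Normal_Form.Matrix"
begin

end

theory Submission
  imports Defs "HOL-Library.Function_Algebras"
begin

text \<open>
  Put \<open>w = u / (k - 1)\<close>, \<open>v = k w\<close> and \<open>x = w + y\<close>, so that \<open>x + u = v + y\<close> and \<open>k x = v + k y\<close>.
  It suffices that, for every fixed \<open>v\<close>, the colours of \<open>v + y\<close> and \<open>v + k y\<close> differ for all but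
  finitely many \<open>y\<close>. Three colourings are combined. If \<open>y\<close> is large in norm, \<open>v\<close> is negligible
  and \<open>\<lceil>2 log\<^sub>k |z|\<rceil>\<close> modulo 4 does the job. If \<open>y\<close> is far up in the filtration by the groups
  \<open>k\<^sup>-\<^sup>e R\<^sup>m\<close>, with \<open>R\<close> the rationals of denominator prime to \<open>k\<close>, then multiplication by \<open>k\<close>
  lowers the level by exactly one, and the parity of the level does the job. If \<open>y\<close> is far
  up in the filtration by the groups \<open>B\<^sub>n = (1/n!) \<int>[1/k]\<^sup>m\<close>, then multiplication by \<open>k\<close> preserves the
  level \<open>n\<close> and permutes the cosets of \<open>B\<^sub>n\<^sub>-\<^sub>k\<close>, moving the coset of \<open>y\<close>; a permutation admits a
  3-colouring that separates every moved point from its image. The remaining \<open>y\<close> are bounded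
  and have a bounded denominator.
\<close>

section \<open>Three-colouring an injective map\<close>

text \<open>In the graph joining each \<open>z\<close> to \<open>g z\<close>, injectivity leaves
  \<open>x\<close> at most two neighbours: \<open>g x\<close> and its only preimage. Hence greedy
  colouring along a well-order always finds a free colour among three.\<close>

lemma injective_map_three_colouring:
  fixes g :: "'a \<Rightarrow> 'a"
  assumes "inj g"
  obtains c :: "'a \<Rightarrow> nat" where "\<And>x. c x < 3" "\<And>x. g x \<noteq> x \<Longrightarrow> c (g x) \<noteq> c x"
proof -
  obtain r :: "'a rel" where r: "Well_order r" "Field r = UNIV"
    using well_ordering by (metis well_order_on_def)
  have wf: "wf (r - Id)" and total: "total r"
    using r by (auto simp: well_order_on_def linear_order_on_def)
  \<comment> \<open>Only neighbours preceding \<open>x\<close> restrict its colour, so the choice is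
    a well-founded recursion; each edge is checked at its later endpoint.\<close>
  define P where "P f x i \<longleftrightarrow> i < (3::nat) \<and>
      (\<forall>y. (y, x) \<in> r - Id \<longrightarrow> y = g x \<or> g y = x \<longrightarrow> f y \<noteq> i)" for f x i
  have "\<exists>c. \<forall>x. P c x (c x)"
  proof (rule dependent_wf_choice[OF wf])
    fix f h :: "'a \<Rightarrow> nat" and x i
    assume "\<And>z. (z, x) \<in> r - Id \<Longrightarrow> f z = h z"
    then show "P f x i = P h x i"
      unfolding P_def by metis
  next
    fix x and f :: "'a \<Rightarrow> nat"
    \<comment> \<open>If \<open>x\<close> has no preimage, \<open>inv_into UNIV g x\<close> is an
      arbitrary element; this merely excludes one more colour.\<close>
    have "\<exists>i<3. i \<noteq> f (g x) \<and> i \<noteq> f (inv_into UNIV g x)"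
    proof -
      have "card ({f (g x), f (inv_into UNIV g x)} :: nat set) \<le> 2"
        by (simp add: card_insert_if)
      then have "\<not> {..<3::nat} \<subseteq> {f (g x), f (inv_into UNIV g x)}"
        using card_mono[of "{f (g x), f (inv_into UNIV g x)}" "{..<3::nat}"] by auto
      then show ?thesis by auto
    qed
    then show "\<exists>i. P f x i"
      unfolding P_def using assms by (metis inv_f_f)
  qed
  then obtain c where c: "\<And>x. P c x (c x)" by blast
  show ?thesis
  proof (rule that)
    show "c x < 3" for x using c by (auto simp: P_def)
    show "c (g x) \<noteq> c x" if "g x \<noteq> x" for x
    proof -
      have "(g x, x) \<in> r - Id \<or> (x, g x) \<in> r - Id"
        using total r(2) that by (auto simp: total_on_def)
      then show ?thesis using c[of x] c[of "g x"] by (auto simp: P_def)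
    qed
  qed
qed

section \<open>Filtrations of an abelian group by subgroups\<close>

definition level :: "(nat \<Rightarrow> 'a set) \<Rightarrow> 'a \<Rightarrow> nat" where
  "level S z = (LEAST n. z \<in> S n)"

locale filtration =
  fixes S :: "nat \<Rightarrow> 'a::ab_group_add set"
  assumes zero_mem: "0 \<in> S n"
    and diff_mem: "x \<in> S n \<Longrightarrow> y \<in> S n \<Longrightarrow> x - y \<in> S n"
    and mono_mem: "x \<in> S n \<Longrightarrow> n \<le> n' \<Longrightarrow> x \<in> S n'"
    and exhaustive: "\<exists>n. x \<in> S n"
begin

lemma uminus_mem: "x \<in> S n \<Longrightarrow> - x \<in> S n"
  using diff_mem[OF zero_mem] by fastforce

lemma add_mem: "x \<in> S n \<Longrightarrow> y \<in> S n \<Longrightarrow> x + y \<in> S n"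
  using diff_mem[OF _ uminus_mem] by fastforce

lemma add_mem_cancel: "x \<in> S n \<Longrightarrow> x + y \<in> S n \<longleftrightarrow> y \<in> S n"
  using add_mem diff_mem by (metis add_diff_cancel_left')

lemma mem_iff_level_le: "x \<in> S n \<longleftrightarrow> level S x \<le> n"
  unfolding level_def by (metis LeastI Least_le exhaustive mono_mem)

lemma level_eqI: "(\<And>n. x \<in> S n \<longleftrightarrow> l \<le> n) \<Longrightarrow> level S x = l"
  using mem_iff_level_le by (meson order_antisym order_refl)

text \<open>The ultrametric principle: from level \<open>level S v\<close> on, adding
  \<open>v\<close> does not affect membership. If \<open>v + y\<close> lay in an earlier group,
  monotonicity would put it in \<open>S (level S v)\<close>, and \<open>y\<close> with it.\<close>

lemma level_add_eq:
  assumes "level S v < level S y"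
  shows "level S (v + y) = level S y"
proof -
  have 1: "v + y \<in> S n \<longleftrightarrow> level S y \<le> n" if "level S v \<le> n" for n
    using that add_mem_cancel mem_iff_level_le by blast
  have 2: "v + y \<notin> S n" if "n \<le> level S v" for n
    using that assms 1 mono_mem by (meson leD order_refl)
  show ?thesis
  proof (rule level_eqI)
    show "v + y \<in> S n \<longleftrightarrow> level S y \<le> n" for n
      using 1[of n] 2[of n] assms by linarith
  qed
qed

definition coset :: "nat \<Rightarrow> 'a \<Rightarrow> 'a set" where
  "coset n z = {w. w - z \<in> S n}"

lemma mem_coset_self: "z \<in> coset n z"
  by (simp add: coset_def zero_mem)

lemma coset_add_eq:
  assumes "v \<in> S n"
  shows "coset n (v + y) = coset n y"
proof -
  have "w - y = v + (w - (v + y))" for w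
    by (simp add: algebra_simps)
  then show ?thesis
    unfolding coset_def using add_mem_cancel[OF assms] by presburger
qed

end

section \<open>Rational vectors and their denominators\<close>

text \<open>Vectors are encoded as functions on all naturals, so that the type is an abelian group
  under pointwise operations and the filtration locale applies.\<close>

definition fscale :: "rat \<Rightarrow> (nat \<Rightarrow> rat) \<Rightarrow> nat \<Rightarrow> rat" where
  "fscale q z = (\<lambda>i. q * z i)"

lemma fscale_diff: "fscale q (x - y) = fscale q x - fscale q y"
  and fscale_fscale: "fscale p (fscale q x) = fscale (p * q) x"
  and fscale_one: "fscale 1 x = x"
  by (auto simp: fscale_def algebra_simps)

definition int_vectors :: "nat \<Rightarrow> (nat \<Rightarrow> rat) set" where
  "int_vectors m = {z. \<forall>i<m. z i \<in> \<int>}"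

lemma int_vectors_add: "x \<in> int_vectors m \<Longrightarrow> y \<in> int_vectors m \<Longrightarrow> x + y \<in> int_vectors m"
  and int_vectors_diff: "x \<in> int_vectors m \<Longrightarrow> y \<in> int_vectors m \<Longrightarrow> x - y \<in> int_vectors m"
  and int_vectors_zero: "fscale q 0 \<in> int_vectors m"
  by (auto simp: int_vectors_def fscale_def)

lemma int_vectors_fscale: "q \<in> \<int> \<Longrightarrow> x \<in> int_vectors m \<Longrightarrow> fscale q x \<in> int_vectors m"
  by (auto simp: int_vectors_def fscale_def)

lemma int_vectors_fscale_dvd:
  assumes "a dvd b" "fscale (of_nat a) x \<in> int_vectors m"
  shows "fscale (of_nat b) x \<in> int_vectors m"
proof -
  obtain c where "b = c * a" using assms(1) by (metis dvd_def mult.commute)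
  then show ?thesis
    using int_vectors_fscale[of "of_nat c", OF _ assms(2)] by (simp add: fscale_fscale)
qed

text \<open>By Bezout, \<open>n\<close> is an integer combination of \<open>a * n\<close> and
  \<open>b * n\<close>.\<close>

lemma int_vectors_fscale_coprime:
  assumes "coprime a b"
    and "fscale (of_nat (a * n)) x \<in> int_vectors m" "fscale (of_nat (b * n)) x \<in> int_vectors m"
  shows "fscale (of_nat n) x \<in> int_vectors m"
proof -
  have "coprime (int a) (int b)" using assms(1) by simp
  then obtain s t where st: "s * int a + t * int b = 1"
    using bezout_int[of "int a" "int b"] by auto
  have "of_int s * of_nat a + of_int t * of_nat b = (of_int (s * int a + t * int b) :: rat)"
    by simp
  then have "of_int s * of_nat a + of_int t * of_nat b = (1::rat)"
    using st by simp
  then have "fscale (of_nat n) x =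
      fscale (of_int s) (fscale (of_nat (a * n)) x) + fscale (of_int t) (fscale (of_nat (b * n)) x)"
    by (auto simp: fscale_def algebra_simps fun_eq_iff) (metis distrib_right mult.assoc mult_1)
  then show ?thesis
    using assms(2,3) int_vectors_add int_vectors_fscale by (metis Ints_of_int)
qed

lemma common_denominator: "\<exists>D>0. fscale (of_nat D) z \<in> int_vectors m"
proof (induction m)
  case 0
  show ?case by (auto simp: int_vectors_def)
next
  case (Suc m)
  then obtain D where D: "D > 0" "fscale (of_nat D) z \<in> int_vectors m" by blast
  obtain a b where ab: "quotient_of (z m) = (a, b)" by fastforce
  then have b: "b > 0" "z m = of_int a / of_int b"
    using quotient_of_denom_pos quotient_of_div by blast+
  have "of_nat (nat b) * z m = of_int a" using b by simp
  then have "of_nat (D * nat b) * z m \<in> \<int>"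
    by (simp add: mult.assoc)
  moreover have "fscale (of_nat (D * nat b)) z \<in> int_vectors m"
    using D(2) by (rule int_vectors_fscale_dvd[rotated]) simp
  ultimately have "fscale (of_nat (D * nat b)) z \<in> int_vectors (Suc m)"
    by (auto simp: int_vectors_def fscale_def less_Suc_eq)
  then show ?case using D(1) b(1) by (intro exI[of _ "D * nat b"]) simp
qed

text \<open>As long as \<open>D\<close> shares a factor \<open>g > 1\<close> with \<open>k\<close>,
  divide it out; since \<open>g\<close> divides \<open>k\<close>, each division costs one power of
  \<open>k\<close>.\<close>

lemma dvd_coprime_times_power:
  fixes D k :: nat
  assumes "D > 0"
  shows "\<exists>d e. coprime d k \<and> D dvd d * k ^ e"
  using assms
proof (induction D rule: less_induct)
  case (less D)
  show ?case
  proof (cases "coprime D k")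
    case True
    then show ?thesis by (intro exI[of _ D] exI[of _ 0]) simp
  next
    case False
    define g where "g = gcd D k"
    have g: "g > 1" "g dvd k"
      using False less.prems by (auto simp: g_def coprime_iff_gcd_eq_1 nat_neq_iff)
    obtain D' where D': "D = g * D'" by (metis dvdE g_def gcd_dvd1)
    have "D' < D" "D' > 0" using D' g less.prems by auto
    then obtain d e where de: "coprime d k" "D' dvd d * k ^ e" using less.IH by blast
    have "D dvd k * (d * k ^ e)" unfolding D' using g(2) de(2) by (rule mult_dvd_mono)
    then have "D dvd d * k ^ Suc e" by (simp add: ac_simps)
    then show ?thesis using de(1) by blast
  qed
qed

section \<open>The two filtrations of rational space\<close>

text \<open>The multiplier \<open>d\<close> clears the part of the denominators prime to
  \<open>k\<close>. For \<open>k \<ge> 2\<close>, coprimality also forces \<open>d\<close> to be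
  nonzero.\<close>

definition power_filtration :: "nat \<Rightarrow> nat \<Rightarrow> nat \<Rightarrow> (nat \<Rightarrow> rat) set" where
  "power_filtration k m e = {z. \<exists>d. coprime d k \<and> fscale (of_nat (d * k ^ e)) z \<in> int_vectors m}"

text \<open>Factorials form a single divisibility chain in which every positive integer divides some
  member, so the groups increase and exhaust all vectors.\<close>

definition factorial_filtration :: "nat \<Rightarrow> nat \<Rightarrow> nat \<Rightarrow> (nat \<Rightarrow> rat) set" where
  "factorial_filtration k m n = {z. \<exists>e. fscale (of_nat (k ^ e * fact n)) z \<in> int_vectors m}"

lemma filtration_power: "filtration (power_filtration k m)"
proof
  fix x y :: "nat \<Rightarrow> rat" and n n' :: nat
  show "0 \<in> power_filtration k m n"
    using coprime_1_left int_vectors_zero unfolding power_filtration_def by blast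
  show "\<exists>n. x \<in> power_filtration k m n"
  proof -
    obtain D where D: "D > 0" "fscale (of_nat D) x \<in> int_vectors m"
      using common_denominator by blast
    then obtain d e where "coprime d k" "D dvd d * k ^ e"
      using dvd_coprime_times_power by blast
    then show ?thesis
      unfolding power_filtration_def using int_vectors_fscale_dvd[OF _ D(2)] by blast
  qed
  assume "x \<in> power_filtration k m n"
  then obtain d where d: "coprime d k" "fscale (of_nat (d * k ^ n)) x \<in> int_vectors m"
    by (auto simp: power_filtration_def)
  show "x \<in> power_filtration k m n'" if "n \<le> n'"
  proof -
    have "d * k ^ n dvd d * k ^ n'" using that by (simp add: le_imp_power_dvd)
    then show ?thesis
      unfolding power_filtration_def using d(1) int_vectors_fscale_dvd[OF _ d(2)] by blast
  qed
  assume "y \<in> power_filtration k m n"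
  then obtain d' where d': "coprime d' k" "fscale (of_nat (d' * k ^ n)) y \<in> int_vectors m"
    by (auto simp: power_filtration_def)
  have coprime: "coprime (d * d') k" using d(1) d'(1) by simp
  have "fscale (of_nat (d * d' * k ^ n)) x \<in> int_vectors m"
    by (rule int_vectors_fscale_dvd[OF _ d(2)]) simp
  moreover have "fscale (of_nat (d * d' * k ^ n)) y \<in> int_vectors m"
    by (rule int_vectors_fscale_dvd[OF _ d'(2)]) simp
  ultimately have "fscale (of_nat (d * d' * k ^ n)) (x - y) \<in> int_vectors m"
    unfolding fscale_diff by (rule int_vectors_diff)
  then show "x - y \<in> power_filtration k m n"
    unfolding power_filtration_def using coprime by blast
qed

lemma filtration_factorial: "filtration (factorial_filtration k m)"
proof
  fix x y :: "nat \<Rightarrow> rat" and n n' :: nat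
  show "0 \<in> factorial_filtration k m n"
    using int_vectors_zero by (auto simp: factorial_filtration_def)
  show "\<exists>n. x \<in> factorial_filtration k m n"
  proof -
    obtain D where D: "D > 0" "fscale (of_nat D) x \<in> int_vectors m"
      using common_denominator by blast
    have "D dvd k ^ 0 * fact D" using D(1) by (simp add: dvd_fact)
    then show ?thesis
      unfolding factorial_filtration_def using int_vectors_fscale_dvd[OF _ D(2)] by blast
  qed
  assume "x \<in> factorial_filtration k m n"
  then obtain e where e: "fscale (of_nat (k ^ e * fact n)) x \<in> int_vectors m"
    by (auto simp: factorial_filtration_def)
  show "x \<in> factorial_filtration k m n'" if "n \<le> n'"
  proof -
    have "k ^ e * fact n dvd k ^ e * (fact n' :: nat)" using that by (simp add: fact_dvd)
    then show ?thesis
      unfolding factorial_filtration_def using int_vectors_fscale_dvd[OF _ e] by blast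
  qed
  assume "y \<in> factorial_filtration k m n"
  then obtain e' where e': "fscale (of_nat (k ^ e' * fact n)) y \<in> int_vectors m"
    by (auto simp: factorial_filtration_def)
  have "fscale (of_nat (k ^ (e + e') * fact n)) x \<in> int_vectors m"
    by (rule int_vectors_fscale_dvd[OF _ e]) (simp add: power_add)
  moreover have "fscale (of_nat (k ^ (e + e') * fact n)) y \<in> int_vectors m"
    by (rule int_vectors_fscale_dvd[OF _ e']) (simp add: power_add)
  ultimately have "fscale (of_nat (k ^ (e + e') * fact n)) (x - y) \<in> int_vectors m"
    unfolding fscale_diff by (rule int_vectors_diff)
  then show "x - y \<in> factorial_filtration k m n"
    unfolding factorial_filtration_def by blast
qed

lemma fscale_mem_power_filtration:
  "fscale (of_nat k) z \<in> power_filtration k m e \<longleftrightarrow> z \<in> power_filtration k m (Suc e)"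
  by (simp add: power_filtration_def fscale_fscale ac_simps)

text \<open>The exponent \<open>e\<close> is free, so a factor \<open>k\<close> can be absorbed into
  it: \<open>k\<close> acts as a unit here.\<close>

lemma fscale_mem_factorial_filtration:
  "fscale (of_nat k) z \<in> factorial_filtration k m n \<longleftrightarrow> z \<in> factorial_filtration k m n"
proof
  assume "fscale (of_nat k) z \<in> factorial_filtration k m n"
  then obtain e where "fscale (of_nat (k ^ e * fact n)) (fscale (of_nat k) z) \<in> int_vectors m"
    by (auto simp: factorial_filtration_def)
  then have "fscale (of_nat (k ^ Suc e * fact n)) z \<in> int_vectors m"
    by (simp add: fscale_fscale ac_simps)
  then show "z \<in> factorial_filtration k m n"
    unfolding factorial_filtration_def by blast
next
  assume "z \<in> factorial_filtration k m n"
  then obtain e where "fscale (of_nat (k ^ e * fact n)) z \<in> int_vectors m"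
    by (auto simp: factorial_filtration_def)
  then have "fscale (of_nat k) (fscale (of_nat (k ^ e * fact n)) z) \<in> int_vectors m"
    by (rule int_vectors_fscale[OF Ints_of_nat])
  then have "fscale (of_nat (k ^ e * fact n)) (fscale (of_nat k) z) \<in> int_vectors m"
    by (simp add: fscale_fscale ac_simps)
  then show "fscale (of_nat k) z \<in> factorial_filtration k m n"
    unfolding factorial_filtration_def by blast
qed

text \<open>Dividing by \<open>j\<close> raises the level by at most \<open>j\<close>, because
  \<open>n! j\<close> divides \<open>n! j!\<close>, which divides \<open>(n + j)!\<close>.\<close>

lemma mem_factorial_filtration_add:
  assumes "0 < j" "fscale (of_nat j) z \<in> factorial_filtration k m n"
  shows "z \<in> factorial_filtration k m (n + j)"
proof -
  obtain e where "fscale (of_nat (k ^ e * fact n * j)) z \<in> int_vectors m"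
    using assms(2) by (auto simp: factorial_filtration_def fscale_fscale)
  moreover have "k ^ e * fact n * j dvd k ^ e * fact (n + j)"
  proof -
    have "fact n * j dvd fact n * (fact j :: nat)"
      using assms(1) by (simp add: dvd_fact)
    also have "\<dots> dvd fact (n + j)" by (rule fact_fact_dvd_fact)
    finally show ?thesis by (simp add: mult.assoc)
  qed
  ultimately show ?thesis
    unfolding factorial_filtration_def using int_vectors_fscale_dvd by blast
qed

text \<open>The two memberships supply unspecified multipliers \<open>d\<close> and
  \<open>k ^ f\<close>. These are coprime and therefore cancel, leaving a denominator bound that
  depends only on the levels.\<close>

lemma mem_int_vectors_of_filtrations:
  assumes "z \<in> power_filtration k m e" "z \<in> factorial_filtration k m n"
  shows "fscale (of_nat (k ^ e * fact n)) z \<in> int_vectors m"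
proof -
  obtain d where d: "coprime d k" "fscale (of_nat (d * k ^ e)) z \<in> int_vectors m"
    using assms(1) by (auto simp: power_filtration_def)
  obtain f where f: "fscale (of_nat (k ^ f * fact n)) z \<in> int_vectors m"
    using assms(2) by (auto simp: factorial_filtration_def)
  show ?thesis
  proof (rule int_vectors_fscale_coprime)
    show "coprime d (k ^ f)" using d(1) by simp
    show "fscale (of_nat (d * (k ^ e * fact n))) z \<in> int_vectors m"
      by (rule int_vectors_fscale_dvd[OF _ d(2)]) simp
    show "fscale (of_nat (k ^ f * (k ^ e * fact n))) z \<in> int_vectors m"
      by (rule int_vectors_fscale_dvd[OF _ f]) simp
  qed
qed

section \<open>Colourings from the two filtrations\<close>

definition colour_power :: "nat \<Rightarrow> nat \<Rightarrow> (nat \<Rightarrow> rat) \<Rightarrow> nat" where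
  "colour_power k m z = level (power_filtration k m) z mod 2"

text \<open>The gap of more than one keeps \<open>k y\<close>, whose level is one below that of
  \<open>y\<close>, still strictly above \<open>v\<close>. Adding \<open>v\<close> then changes
  neither level, and the parities differ.\<close>

lemma colour_power_neq:
  assumes "level (power_filtration k m) y > Suc (level (power_filtration k m) v)"
  shows "colour_power k m (v + y) \<noteq> colour_power k m (v + fscale (of_nat k) y)"
proof -
  interpret filtration "power_filtration k m" by (rule filtration_power)
  let ?l = "level (power_filtration k m)"
  have "?l (fscale (of_nat k) y) = ?l y - 1"
  proof (rule level_eqI)
    show "fscale (of_nat k) y \<in> power_filtration k m n \<longleftrightarrow> ?l y - 1 \<le> n" for n
      using fscale_mem_power_filtration[of k y m n] mem_iff_level_le[of y "Suc n"] by auto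
  qed
  moreover from this have "?l (v + fscale (of_nat k) y) = ?l (fscale (of_nat k) y)"
    using assms by (intro level_add_eq) simp
  moreover have "?l (v + y) = ?l y"
    using assms by (intro level_add_eq) simp
  ultimately have "?l (v + y) = Suc (?l (v + fscale (of_nat k) y))"
    using assms by simp
  then show ?thesis
    unfolding colour_power_def by presburger
qed

text \<open>The colour of \<open>z\<close> is that of its coset modulo the group \<open>k\<close>
  levels below its own. Both vectors have the level of \<open>y\<close>, and \<open>v\<close>
  vanishes modulo that lower group, so the cosets compared are those of \<open>y\<close> and
  \<open>k y\<close>.\<close>

lemma colour_factorial:
  assumes "k \<ge> 2"
  obtains c :: "(nat \<Rightarrow> rat) \<Rightarrow> nat" where
    "\<And>z. c z < 3"
    "\<And>v y. level (factorial_filtration k m) y > level (factorial_filtration k m) v + k \<Longrightarrow>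
       c (v + y) \<noteq> c (v + fscale (of_nat k) y)"
proof -
  interpret filtration "factorial_filtration k m" by (rule filtration_factorial)
  let ?l = "level (factorial_filtration k m)" and ?K = "fscale (of_nat k)"
  have inv: "fscale (1 / of_nat k) (?K z) = z" "?K (fscale (1 / of_nat k) z) = z" for z
    using assms by (simp_all add: fscale_fscale fscale_one)
  then have "inj ?K" by (metis injI)
  \<comment> \<open>The three-colouring is applied to the image map on arbitrary sets of vectors;
    cosets are then mapped to cosets.\<close>
  then have "inj ((`) ?K)" by (simp add: inj_on_image_Pow inj_image_eq_iff inj_def)
  then obtain h :: "(nat \<Rightarrow> rat) set \<Rightarrow> nat" where
    h: "\<And>C. h C < 3" "\<And>C. ?K ` C \<noteq> C \<Longrightarrow> h (?K ` C) \<noteq> h C"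
    by (rule injective_map_three_colouring) blast
  have image_coset: "?K ` coset n y = coset n (?K y)" for n y
  proof (intro equalityI subsetI)
    fix w assume "w \<in> ?K ` coset n y"
    then show "w \<in> coset n (?K y)"
      by (auto simp: coset_def fscale_mem_factorial_filtration simp flip: fscale_diff)
  next
    fix w assume "w \<in> coset n (?K y)"
    then have "?K (fscale (1 / of_nat k) w - y) \<in> factorial_filtration k m n"
      by (simp add: coset_def fscale_diff inv)
    then have "fscale (1 / of_nat k) w \<in> coset n y"
      by (simp add: coset_def fscale_mem_factorial_filtration)
    then show "w \<in> ?K ` coset n y" using inv(2) by (metis imageI)
  qed
  show ?thesis
  proof (rule that)
    show "h (coset (?l z - k) z) < 3" for z by (rule h(1))
    fix v y assume less: "?l y > ?l v + k"
    have lK: "?l (?K y) = ?l y"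
      using fscale_mem_factorial_filtration mem_iff_level_le by (intro level_eqI) blast
    have l: "?l (v + y) = ?l y" "?l (v + ?K y) = ?l y"
      using level_add_eq[of v y] level_add_eq[of v "?K y"] less lK by simp_all
    let ?n = "?l y - k"
    have "v \<in> factorial_filtration k m ?n" using less by (simp add: mem_iff_level_le)
    then have c: "coset ?n (v + y) = coset ?n y" "coset ?n (v + ?K y) = ?K ` coset ?n y"
      by (simp_all add: coset_add_eq image_coset)
    \<comment> \<open>A fixed coset would put \<open>(k - 1) y\<close> at level at most
      \<open>?l y - k\<close>. Dividing by \<open>k - 1\<close> would then put \<open>y\<close> at
      level at most \<open>?l y - 1\<close>; this is why the cosets are taken \<open>k\<close>
      levels down.\<close>
    have "?K ` coset ?n y \<noteq> coset ?n y"
    proof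
      assume "?K ` coset ?n y = coset ?n y"
      then have "?K y \<in> coset ?n y" using mem_coset_self image_coset by metis
      then have "?K y - y \<in> factorial_filtration k m ?n" by (simp add: coset_def)
      moreover have "?K y - y = fscale (of_nat (k - 1)) y"
        using assms by (simp add: fscale_def of_nat_diff algebra_simps fun_eq_iff)
      ultimately have "y \<in> factorial_filtration k m (?n + (k - 1))"
        using assms by (intro mem_factorial_filtration_add) auto
      then show False using less assms by (simp add: mem_iff_level_le)
    qed
    then show "h (coset (?l (v + y) - k) (v + y)) \<noteq> h (coset (?l (v + ?K y) - k) (v + ?K y))"
      using h(2)[of "coset ?n y"] by (simp add: l c)
  qed
qed

section \<open>Colouring by the norm\<close>

definition size_norm :: "nat \<Rightarrow> (nat \<Rightarrow> rat) \<Rightarrow> real" where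
  "size_norm m z = (\<Sum>i<m. \<bar>of_rat (z i)\<bar>)"

lemma size_norm_nonneg: "0 \<le> size_norm m z"
  by (simp add: size_norm_def sum_nonneg)

lemma size_norm_add: "size_norm m (x + y) \<le> size_norm m x + size_norm m y"
  unfolding size_norm_def sum.distrib[symmetric]
  by (rule sum_mono) (metis abs_triangle_ineq of_rat_add plus_fun_apply)

lemma size_norm_fscale: "size_norm m (fscale (of_nat k) x) = real k * size_norm m x"
  by (simp add: size_norm_def fscale_def of_rat_mult abs_mult sum_distrib_left)

lemma size_norm_uminus: "size_norm m (- x) = size_norm m x"
  by (simp add: size_norm_def of_rat_minus)

lemma size_norm_le_add: "size_norm m y - size_norm m v \<le> size_norm m (v + y)"
  using size_norm_add[of m "v + y" "- v"] by (simp add: size_norm_uminus)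

definition colour_size :: "nat \<Rightarrow> nat \<Rightarrow> (nat \<Rightarrow> rat) \<Rightarrow> nat" where
  "colour_size k m z = nat (\<lceil>log (real k) ((size_norm m z)\<^sup>2)\<rceil> mod 4)"

text \<open>
  Multiplication by \<open>k\<close> raises the logarithm of the squared norm by 2; as the perturbation by
  \<open>v\<close> changes this by at most 1, the ceilings differ by 1, 2 or 3.
\<close>
lemma colour_size_neq:
  assumes "k \<ge> 2" "size_norm m y > 10 * size_norm m v"
  shows "colour_size k m (v + y) \<noteq> colour_size k m (v + fscale (of_nat k) y)"
proof -
  let ?a = "size_norm m v" and ?b = "size_norm m y" and ?r = "real k"
  let ?A = "size_norm m (v + y)" and ?B = "size_norm m (v + fscale (of_nat k) y)"
  have r: "?r \<ge> 2" using assms(1) by simp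
  have a: "0 \<le> ?a" by (rule size_norm_nonneg)
  have b: "0 < ?b" using a assms(2) by linarith
  \<comment> \<open>The factor 10 in the hypothesis means that \<open>v\<close> shifts either norm
    by less than a tenth of \<open>?b\<close>.\<close>
  have A: "9/10 * ?b \<le> ?A" "?A \<le> 11/10 * ?b"
    using size_norm_le_add[of m y v] size_norm_add[of m v y] assms(2) by auto
  have B: "(?r - 1/10) * ?b \<le> ?B" "?B \<le> (?r + 1/10) * ?b"
    using size_norm_le_add[of m "fscale (of_nat k) y" v] size_norm_add[of m v "fscale (of_nat k) y"] assms(2)
    by (auto simp: size_norm_fscale algebra_simps)
  have Apos: "0 < ?A" using A b by linarith
  have "0 < (?r - 1/10) * ?b" using r b by simp
  then have Bpos: "0 < ?B" using B by linarith
  \<comment> \<open>It suffices that \<open>1.21 r \<le> (r - 0.1)^2\<close>, which follows from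
    \<open>2 r \<le> r^2\<close>.\<close>
  have "?r * ?A\<^sup>2 \<le> ?B\<^sup>2"
  proof -
    have "?r * ?A\<^sup>2 \<le> ?r * (11/10 * ?b)\<^sup>2"
      using A Apos r by (intro mult_left_mono power_mono) auto
    also have "\<dots> = (?r * (121/100)) * ?b\<^sup>2"
      by (simp add: power2_eq_square)
    also have "\<dots> \<le> (?r - 1/10)\<^sup>2 * ?b\<^sup>2"
    proof (rule mult_right_mono)
      have "(?r - 1/10)\<^sup>2 = ?r * ?r - ?r / 5 + 1/100"
        by (simp add: power2_eq_square field_simps)
      moreover have "2 * ?r \<le> ?r * ?r" using r by (intro mult_right_mono) auto
      ultimately show "?r * (121/100) \<le> (?r - 1/10)\<^sup>2"
        using r by linarith
    qed simp
    also have "\<dots> = ((?r - 1/10) * ?b)\<^sup>2" by (simp add: power_mult_distrib)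
    also have "\<dots> \<le> ?B\<^sup>2" using B r b by (intro power_mono) auto
    finally show ?thesis .
  qed
  then have "log ?r (?r * ?A\<^sup>2) \<le> log ?r (?B\<^sup>2)"
    using r Apos Bpos by simp
  then have lower: "1 + log ?r (?A\<^sup>2) \<le> log ?r (?B\<^sup>2)"
    using r Apos by (subst (asm) log_mult) auto
  \<comment> \<open>It suffices that \<open>(r + 0.1)^2 \<le> 0.81 r^3\<close>, which follows from
    \<open>2 r \<le> r^2\<close> and \<open>2 r^2 \<le> r^3\<close>.\<close>
  have "?B\<^sup>2 \<le> ?r ^ 3 * ?A\<^sup>2"
  proof -
    have "?B\<^sup>2 \<le> ((?r + 1/10) * ?b)\<^sup>2"
      using B Bpos by (intro power_mono) auto
    also have "\<dots> = (?r + 1/10)\<^sup>2 * ?b\<^sup>2" by (simp add: power_mult_distrib)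
    also have "\<dots> \<le> (?r ^ 3 * (81/100)) * ?b\<^sup>2"
    proof (rule mult_right_mono)
      have "(?r + 1/10)\<^sup>2 = ?r * ?r + ?r / 5 + 1/100"
        by (simp add: power2_eq_square field_simps)
      moreover have "2 * ?r \<le> ?r * ?r" "2 * (?r * ?r) \<le> ?r ^ 3"
        using r by (auto simp: power3_eq_cube mult.assoc intro!: mult_right_mono)
      ultimately show "(?r + 1/10)\<^sup>2 \<le> ?r ^ 3 * (81/100)"
        using r by linarith
    qed simp
    also have "\<dots> = ?r ^ 3 * (9/10 * ?b)\<^sup>2" by (simp add: power2_eq_square)
    also have "\<dots> \<le> ?r ^ 3 * ?A\<^sup>2"
      using A b r by (intro mult_left_mono power_mono) auto
    finally show ?thesis .
  qed
  then have "log ?r (?B\<^sup>2) \<le> log ?r (?r ^ 3 * ?A\<^sup>2)"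
    using r Apos Bpos by simp
  then have upper: "log ?r (?B\<^sup>2) \<le> 3 + log ?r (?A\<^sup>2)"
    using r Apos by (subst (asm) log_mult) (auto simp: log_nat_power)
  define s t where "s = \<lceil>log ?r (?A\<^sup>2)\<rceil>" and "t = \<lceil>log ?r (?B\<^sup>2)\<rceil>"
  have "s + 1 \<le> t" "t \<le> s + 3" using lower upper unfolding s_def t_def by linarith+
  then have "s mod 4 \<noteq> t mod 4" by presburger
  then show ?thesis
    unfolding colour_size_def s_def[symmetric] t_def[symmetric] by (simp add: eq_nat_nat_iff)
qed

section \<open>Finiteness of bounded sets with bounded denominators\<close>

lemma finite_bounded_denominator:
  assumes "D > 0"
  shows "finite {q :: rat. of_nat D * q \<in> \<int> \<and> \<bar>real_of_rat q\<bar> \<le> R}"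
proof (rule finite_subset)
  let ?M = "\<lceil>real D * R\<rceil>"
  show "{q :: rat. of_nat D * q \<in> \<int> \<and> \<bar>real_of_rat q\<bar> \<le> R}
      \<subseteq> (\<lambda>j. of_int j / of_nat D) ` {- ?M..?M}"
  proof
    fix q :: rat
    assume "q \<in> {q. of_nat D * q \<in> \<int> \<and> \<bar>real_of_rat q\<bar> \<le> R}"
    then obtain j where j: "of_nat D * q = of_int j" and q: "\<bar>real_of_rat q\<bar> \<le> R"
      by (auto elim: Ints_cases)
    have "real_of_int j = real D * real_of_rat q"
      using j by (metis of_rat_mult of_rat_of_int_eq of_rat_of_nat_eq)
    then have "\<bar>real_of_int j\<bar> \<le> real D * R"
      using q by (simp add: abs_mult mult_left_mono)
    then have "j \<in> {- ?M..?M}" by (auto simp: abs_le_iff) linarith+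
    moreover have "q = of_int j / of_nat D" using j assms by (simp add: field_simps)
    ultimately show "q \<in> (\<lambda>j. of_int j / of_nat D) ` {- ?M..?M}" by blast
  qed
qed simp

text \<open>Each of the first \<open>m\<close> coordinates has finitely many possible values. The
  others, which neither \<open>int_vectors\<close> nor \<open>size_norm\<close> sees, are fixed at
  zero.\<close>

lemma finite_bounded_denominator_functions:
  assumes "D > 0"
  shows "finite {z. (\<forall>i\<ge>m. z i = 0) \<and> fscale (of_nat D) z \<in> int_vectors m \<and> size_norm m z \<le> R}"
    (is "finite ?F")
proof (rule finite_subset)
  let ?Q = "{q :: rat. of_nat D * q \<in> \<int> \<and> \<bar>real_of_rat q\<bar> \<le> R}"
  show "?F \<subseteq> {z. \<forall>i. (i \<in> {..<m} \<longrightarrow> z i \<in> ?Q) \<and> (i \<notin> {..<m} \<longrightarrow> z i = 0)}"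
  proof
    fix z assume z: "z \<in> ?F"
    have "\<bar>real_of_rat (z i)\<bar> \<le> R" if "i < m" for i
    proof -
      have "\<bar>real_of_rat (z i)\<bar> \<le> size_norm m z"
        unfolding size_norm_def using that by (intro member_le_sum) auto
      then show ?thesis using z by simp
    qed
    then show "z \<in> {z. \<forall>i. (i \<in> {..<m} \<longrightarrow> z i \<in> ?Q) \<and> (i \<notin> {..<m} \<longrightarrow> z i = 0)}"
      using z by (auto simp: int_vectors_def fscale_def)
  qed
  show "finite {z. \<forall>i. (i \<in> {..<m} \<longrightarrow> z i \<in> ?Q) \<and> (i \<notin> {..<m} \<longrightarrow> z i = 0)}"
    using finite_bounded_denominator[OF assms] by (intro finite_set_of_finite_funs) auto
qed

section \<open>Combining the three colourings\<close>

lemma function_colouring: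
  fixes k m :: nat
  assumes "k \<ge> 2"
  obtains c :: "(nat \<Rightarrow> rat) \<Rightarrow> nat" where
    "\<And>z. c z < 24"
    "\<And>v. finite {y. (\<forall>i\<ge>m. y i = 0) \<and> c (v + y) = c (v + fscale (of_nat k) y)}"
proof -
  obtain h :: "(nat \<Rightarrow> rat) \<Rightarrow> nat" where
    h: "\<And>z. h z < 3"
    "\<And>v y. level (factorial_filtration k m) y > level (factorial_filtration k m) v + k \<Longrightarrow>
       h (v + y) \<noteq> h (v + fscale (of_nat k) y)"
    by (rule colour_factorial[OF assms, of m]) blast
  \<comment> \<open>A mixed-radix code with digits below 4, 2 and 3, hence \<open>24\<close> values;
    division with remainder recovers each digit.\<close>
  define c where "c z = colour_size k m z + 4 * (colour_power k m z + 2 * h z)" for z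
  have size: "colour_size k m z < 4" and power: "colour_power k m z < 2" for z
    by (auto simp: colour_size_def colour_power_def nat_less_iff)
  have cD: "colour_size k m x = colour_size k m y \<and> colour_power k m x = colour_power k m y \<and> h x = h y"
    if "c x = c y" for x y
  proof -
    have "c z mod 4 = colour_size k m z" "c z div 4 = colour_power k m z + 2 * h z" for z
      using size[of z] unfolding c_def by (simp_all only: mod_mult_self2 mod_less div_mult_self2 div_less)
    moreover have "(colour_power k m z + 2 * h z) mod 2 = colour_power k m z"
      "(colour_power k m z + 2 * h z) div 2 = h z" for z
      using power[of z] by simp_all
    ultimately show ?thesis using that by metis
  qed
  show ?thesis
  proof (rule that)
    show "c z < 24" for z
    proof -
      have "colour_size k m z \<le> 3" "colour_power k m z \<le> 1" "h z \<le> 2"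
        using size[of z] power[of z] h(1)[of z] by simp_all
      then show ?thesis unfolding c_def by simp
    qed
    fix v
    \<comment> \<open>\<open>e\<close> and \<open>n\<close> are the thresholds of the two filtration
      colourings: agreement of colours keeps the levels of \<open>y\<close> at or below
      them.\<close>
    define e where "e = Suc (level (power_filtration k m) v)"
    define n where "n = level (factorial_filtration k m) v + k"
    show "finite {y. (\<forall>i\<ge>m. y i = 0) \<and> c (v + y) = c (v + fscale (of_nat k) y)}"
    proof (rule finite_subset)
      show "finite {y. (\<forall>i\<ge>m. y i = 0) \<and> fscale (of_nat (k ^ e * fact n)) y \<in> int_vectors m
          \<and> size_norm m y \<le> 10 * size_norm m v}"
        using assms by (intro finite_bounded_denominator_functions) simp
      have "fscale (of_nat (k ^ e * fact n)) y \<in> int_vectors m \<and> size_norm m y \<le> 10 * size_norm m v"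
        if "c (v + y) = c (v + fscale (of_nat k) y)" for y
      proof
        note eq = cD[OF that]
        show "size_norm m y \<le> 10 * size_norm m v"
          using colour_size_neq[OF assms] eq not_le by blast
        have "level (power_filtration k m) y \<le> e"
          using colour_power_neq eq not_le e_def by blast
        moreover have "level (factorial_filtration k m) y \<le> n"
          using h(2) eq not_le n_def by blast
        ultimately show "fscale (of_nat (k ^ e * fact n)) y \<in> int_vectors m"
          using filtration.mem_iff_level_le[OF filtration_power]
            filtration.mem_iff_level_le[OF filtration_factorial]
          by (intro mem_int_vectors_of_filtrations) blast+
      qed
      then show "{y. (\<forall>i\<ge>m. y i = 0) \<and> c (v + y) = c (v + fscale (of_nat k) y)}
        \<subseteq> {y. (\<forall>i\<ge>m. y i = 0) \<and> fscale (of_nat (k ^ e * fact n)) y \<in> int_vectors m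
          \<and> size_norm m y \<le> 10 * size_norm m v}"
        by blast
    qed
  qed
qed

section \<open>Transfer to vectors of dimension \<open>m\<close>\<close>

definition coords :: "nat \<Rightarrow> rat vec \<Rightarrow> nat \<Rightarrow> rat" where
  "coords m x = (\<lambda>i. if i < m then x $ i else 0)"

lemma inj_on_coords: "inj_on (coords m) (carrier_vec m)"
  by (rule inj_onI) (auto simp: coords_def fun_eq_iff intro!: eq_vecI split: if_splits)

lemma coords_add: "u \<in> carrier_vec m \<Longrightarrow> coords m (x + u) = coords m x + coords m u"
  by (auto simp: coords_def fun_eq_iff)

lemma coords_smult: "x \<in> carrier_vec m \<Longrightarrow> coords m (a \<cdot>\<^sub>v x) = fscale a (coords m x)"
  by (auto simp: coords_def fscale_def fun_eq_iff)

theorem theorem2p5: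
  fixes k m :: nat
  assumes "k \<ge> 2"
  shows "\<exists>c :: rat vec \<Rightarrow> nat.
           c ` carrier_vec m \<subseteq> {..<72} \<and>
           (\<forall>u \<in> carrier_vec m. \<forall>X. X \<subseteq> carrier_vec m \<and> infinite X \<longrightarrow>
              (\<exists>x \<in> X. c (x + u) \<noteq> c (of_nat k \<cdot>\<^sub>v x)))"
proof -
  obtain c :: "(nat \<Rightarrow> rat) \<Rightarrow> nat" where c: "\<And>z. c z < 24"
    "\<And>v. finite {y. (\<forall>i\<ge>m. y i = 0) \<and> c (v + y) = c (v + fscale (of_nat k) y)}"
    by (rule function_colouring[OF assms, of m]) blast
  have "finite X" if u: "u \<in> carrier_vec m" and X: "X \<subseteq> carrier_vec m"
    and eq: "\<And>x. x \<in> X \<Longrightarrow> c (coords m (x + u)) = c (coords m (of_nat k \<cdot>\<^sub>v x))" for u X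
  proof -
    \<comment> \<open>\<open>w\<close> is the solution of \<open>k w = w + u\<close>, the point
      where the two compared vectors coincide; \<open>k \<ge> 2\<close> makes \<open>k - 1\<close>
      invertible. Subtracting it from the points of \<open>X\<close> leaves the single perturbation
      \<open>v\<close> on both sides.\<close>
    define w where "w = fscale (1 / of_nat (k - 1)) (coords m u)"
    define v where "v = fscale (of_nat k) w"
    let ?Y = "{y. (\<forall>i\<ge>m. y i = 0) \<and> c (v + y) = c (v + fscale (of_nat k) y)}"
    have "fscale (of_nat (k - 1)) w = coords m u"
      using assms by (simp add: w_def fscale_fscale fscale_one)
    then have v: "v = w + coords m u"
      using assms by (auto simp: v_def fscale_def fun_eq_iff of_nat_diff algebra_simps)
    have "coords m x - w \<in> ?Y" if x: "x \<in> X" for x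
    proof -
      have "v + (coords m x - w) = coords m (x + u)"
        using u by (simp add: v coords_add)
      moreover have "v + fscale (of_nat k) (coords m x - w) = coords m (of_nat k \<cdot>\<^sub>v x)"
        using X x by (auto simp: v_def coords_smult fscale_diff)
      ultimately show ?thesis
        using eq[OF x] by (simp add: coords_def w_def fscale_def)
    qed
    then have "(\<lambda>x. coords m x - w) ` X \<subseteq> ?Y" by blast
    then have "finite ((\<lambda>x. coords m x - w) ` X)" using c(2) finite_subset by blast
    moreover have "inj_on (\<lambda>x. coords m x - w) X"
      using inj_on_subset[OF inj_on_coords X] by (simp add: inj_on_def)
    ultimately show ?thesis by (rule finite_imageD)
  qed
  then have "\<forall>u \<in> carrier_vec m. \<forall>X. X \<subseteq> carrier_vec m \<and> infinite X \<longrightarrow>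
      (\<exists>x \<in> X. (c \<circ> coords m) (x + u) \<noteq> (c \<circ> coords m) (of_nat k \<cdot>\<^sub>v x))"
    unfolding o_apply by blast
  \<comment> \<open>The constructed colouring takes values below 24, within the 72 colours
    allowed.\<close>
  moreover have "c z < 72" for z using c(1)[of z] by simp
  ultimately show ?thesis
    by (intro exI[of _ "c \<circ> coords m"]) auto
qed

end
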